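(* Let $\alpha:G\curvearrowright X$ be an expansive partial action of a discrete group $G$ on the Cantor space $X$, and suppose that the partial transformation groupoid $G\ltimes_\alpha X$ is compactly generated. Then $G\ltimes_\alpha X$ is an expansive groupoid.
   Context: Partial action: let $G$ act by homeomorphisms on a topological space $Y$, and let $X\subset Y$ be an open subset meeting every $G$-orbit; the restriction of the action to $X$ is called a partial action $\alpha:G\curvearrowright X$. Its partial transformation groupoid is $G\ltimes_\alpha X=\{(g,x)\in G\times X: gx\in X\}$ with $s(g,x)=x$, $r(g,x)=gx$, $(g,hx)(h,x)=(gh,x)$, and the topology with basis the sets $\{g\}\times W$, with $W\subset X$ open and $g(W)\subset X$. Expansive partial action: fixing a compatible metric $d$ on $X$, there is $\epsilon>0$ such that for all $x\neq y$ in $X$ there is $g\in G$ (with $gx,gy\in X$) such that $d(gx,gy)>\epsilon$. For an étale groupoid $\mathcal{G}$ with Cantor unit space: a compact generating set is a compact $K\subset\mathcal{G}$ with $\mathcal{G}=\bigcup_{n\in\mathbb{N}}(K\cup K^{-1})^n$; $\mathcal{G}$ is compactly generated if one exists. A bisection is an open subset $B\subset\mathcal{G}$ on which $s$ and $r$ are homeomorphisms onto open subsets of $\mathcal{G}^{(0)}$. A finite cover $\mathcal{B}=\{B_i\}_{i=1}^N$ of a compact generating set by bisections is called expansive if $\bigcup_{n\in\mathbb{N}}(\mathcal{B}\cup\mathcal{B}^{-1})^n$ (the set of all finite products of elements of $\mathcal{B}$ and their inverses) is a basis for the topology of $\mathcal{G}$. $\mathcal{G}$ is expansive if there is a compact generating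 set $K$ with an expansive cover $\mathcal{B}$. *)

theory Defs
  imports "HOL-Analysis.Analysis" "HOL-Algebra.Group_Action"
begin

section \<open>General topology\<close>

definition cantor_space :: "'a topology \<Rightarrow> bool" where
  "cantor_space X \<longleftrightarrow>
     X homeomorphic_space product_topology (\<lambda>_. discrete_topology (UNIV :: bool set)) (UNIV :: nat set)"

definition is_basis :: "'a topology \<Rightarrow> 'a set set \<Rightarrow> bool" where
  "is_basis X \<B> \<longleftrightarrow> openin X = arbitrary union_of (\<lambda>U. U \<in> \<B>)"

text \<open>\<open>f\<close> restricts to a homeomorphism from \<open>B\<close> onto an open subset of \<open>X\<close>.\<close>

definition homeo_onto_open :: "'a topology \<Rightarrow> 'b topology \<Rightarrow> ('a \<Rightarrow> 'b) \<Rightarrow> 'a set \<Rightarrow> bool" where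
  "homeo_onto_open A X f B \<longleftrightarrow>
     openin X (f ` B) \<and> homeomorphic_map (subtopology A B) (subtopology X (f ` B)) f"


section \<open>Etale groupoids\<close>

text \<open>
  The unit space and the space of arrows are kept as two separate topological spaces;
  a unit \<open>x\<close> is identified with the identity arrow \<open>gid \<G> x\<close>.  As \<open>gid\<close> is a continuous
  section of the continuous map \<open>src\<close>, it is a homeomorphism onto its image, so this is the
  usual picture in which the unit space is a subspace of the groupoid.
  The product \<open>gmult \<G> a b\<close> is only meaningful when \<open>src \<G> a = rng \<G> b\<close>.
\<close>

record ('x, 'a) groupoid =
  units :: "'x topology"
  arrows :: "'a topology"
  src :: "'a \<Rightarrow> 'x"
  rng :: "'a \<Rightarrow> 'x"
  gid :: "'x \<Rightarrow> 'a"
  gmult :: "'a \<Rightarrow> 'a \<Rightarrow> 'a"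
  ginv :: "'a \<Rightarrow> 'a"

definition composable :: "('x, 'a) groupoid \<Rightarrow> ('a \<times> 'a) set" where
  "composable \<G> =
     {(a, b). a \<in> topspace (arrows \<G>) \<and> b \<in> topspace (arrows \<G>) \<and> src \<G> a = rng \<G> b}"

locale topological_groupoid =
  fixes \<G> :: "('x, 'a) groupoid"
  assumes src_mult: "\<And>a b. (a, b) \<in> composable \<G> \<Longrightarrow> src \<G> (gmult \<G> a b) = src \<G> b"
    and rng_mult: "\<And>a b. (a, b) \<in> composable \<G> \<Longrightarrow> rng \<G> (gmult \<G> a b) = rng \<G> a"
    and mult_assoc: "\<And>a b c. (a, b) \<in> composable \<G> \<Longrightarrow> (b, c) \<in> composable \<G> \<Longrightarrow>
           gmult \<G> (gmult \<G> a b) c = gmult \<G> a (gmult \<G> b c)"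
    and src_gid: "\<And>x. x \<in> topspace (units \<G>) \<Longrightarrow> src \<G> (gid \<G> x) = x"
    and rng_gid: "\<And>x. x \<in> topspace (units \<G>) \<Longrightarrow> rng \<G> (gid \<G> x) = x"
    and mult_gid: "\<And>a. a \<in> topspace (arrows \<G>) \<Longrightarrow> gmult \<G> a (gid \<G> (src \<G> a)) = a"
    and gid_mult: "\<And>a. a \<in> topspace (arrows \<G>) \<Longrightarrow> gmult \<G> (gid \<G> (rng \<G> a)) a = a"
    and src_ginv: "\<And>a. a \<in> topspace (arrows \<G>) \<Longrightarrow> src \<G> (ginv \<G> a) = rng \<G> a"
    and rng_ginv: "\<And>a. a \<in> topspace (arrows \<G>) \<Longrightarrow> rng \<G> (ginv \<G> a) = src \<G> a"
    and ginv_mult: "\<And>a. a \<in> topspace (arrows \<G>) \<Longrightarrow> gmult \<G> (ginv \<G> a) a = gid \<G> (src \<G> a)"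
    and mult_ginv: "\<And>a. a \<in> topspace (arrows \<G>) \<Longrightarrow> gmult \<G> a (ginv \<G> a) = gid \<G> (rng \<G> a)"
    and continuous_src: "continuous_map (arrows \<G>) (units \<G>) (src \<G>)"
    and continuous_rng: "continuous_map (arrows \<G>) (units \<G>) (rng \<G>)"
    and continuous_gid: "continuous_map (units \<G>) (arrows \<G>) (gid \<G>)"
    and continuous_ginv: "continuous_map (arrows \<G>) (arrows \<G>) (ginv \<G>)"
    and continuous_gmult:
      "continuous_map (subtopology (prod_topology (arrows \<G>) (arrows \<G>)) (composable \<G>)) (arrows \<G>)
         (\<lambda>(a, b). gmult \<G> a b)"

locale etale_groupoid = topological_groupoid +
  assumes src_local_homeo: "\<And>a. a \<in> topspace (arrows \<G>) \<Longrightarrow>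
    \<exists>U. openin (arrows \<G>) U \<and> a \<in> U \<and> homeo_onto_open (arrows \<G>) (units \<G>) (src \<G>) U"

definition set_mult :: "('x, 'a) groupoid \<Rightarrow> 'a set \<Rightarrow> 'a set \<Rightarrow> 'a set" where
  "set_mult \<G> A B = {gmult \<G> a b | a b. a \<in> A \<and> b \<in> B \<and> src \<G> a = rng \<G> b}"

text \<open>The exponent is shifted: \<open>set_pow \<G> S n\<close> is $S^{n+1}$, and likewise for families of sets.
  Thus only products with at least one factor are formed.\<close>

primrec set_pow :: "('x, 'a) groupoid \<Rightarrow> 'a set \<Rightarrow> nat \<Rightarrow> 'a set" where
  "set_pow \<G> S 0 = S"
| "set_pow \<G> S (Suc n) = set_mult \<G> S (set_pow \<G> S n)"

primrec family_pow :: "('x, 'a) groupoid \<Rightarrow> 'a set set \<Rightarrow> nat \<Rightarrow> 'a set set" where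
  "family_pow \<G> \<S> 0 = \<S>"
| "family_pow \<G> \<S> (Suc n) = {set_mult \<G> A B | A B. A \<in> \<S> \<and> B \<in> family_pow \<G> \<S> n}"

definition compact_generating_set :: "('x, 'a) groupoid \<Rightarrow> 'a set \<Rightarrow> bool" where
  "compact_generating_set \<G> K \<longleftrightarrow>
     compactin (arrows \<G>) K \<and> topspace (arrows \<G>) = (\<Union>n. set_pow \<G> (K \<union> ginv \<G> ` K) n)"

definition compactly_generated :: "('x, 'a) groupoid \<Rightarrow> bool" where
  "compactly_generated \<G> \<longleftrightarrow> (\<exists>K. compact_generating_set \<G> K)"

definition bisection :: "('x, 'a) groupoid \<Rightarrow> 'a set \<Rightarrow> bool" where
  "bisection \<G> B \<longleftrightarrow> openin (arrows \<G>) B \<and>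
     homeo_onto_open (arrows \<G>) (units \<G>) (src \<G>) B \<and>
     homeo_onto_open (arrows \<G>) (units \<G>) (rng \<G>) B"

definition expansive_cover :: "('x, 'a) groupoid \<Rightarrow> 'a set \<Rightarrow> 'a set set \<Rightarrow> bool" where
  "expansive_cover \<G> K \<B> \<longleftrightarrow>
     finite \<B> \<and> (\<forall>B\<in>\<B>. bisection \<G> B) \<and> K \<subseteq> \<Union>\<B> \<and>
     is_basis (arrows \<G>) (\<Union>n. family_pow \<G> (\<B> \<union> (`) (ginv \<G>) ` \<B>) n)"

definition expansive_groupoid :: "('x, 'a) groupoid \<Rightarrow> bool" where
  "expansive_groupoid \<G> \<longleftrightarrow>
     etale_groupoid \<G> \<and> cantor_space (units \<G>) \<and>
     (\<exists>K \<B>. compact_generating_set \<G> K \<and> expansive_cover \<G> K \<B>)"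


section \<open>Partial actions\<close>

locale partial_action = group_action G "topspace Y" \<phi>
  for G (structure) and Y :: "'y topology" and \<phi> +
  fixes X :: "'y set"
  assumes homeo: "\<And>g. g \<in> carrier G \<Longrightarrow> homeomorphic_map Y Y (\<phi> g)"
    and open_X: "openin Y X"
    and meets_orbits: "\<And>S. S \<in> orbits G (topspace Y) \<phi> \<Longrightarrow> X \<inter> S \<noteq> {}"

definition expansive_partial_action ::
  "('g, 'm) monoid_scheme \<Rightarrow> ('g \<Rightarrow> 'y \<Rightarrow> 'y) \<Rightarrow> 'y set \<Rightarrow> ('y \<Rightarrow> 'y \<Rightarrow> real) \<Rightarrow> bool" where
  "expansive_partial_action G \<phi> X d \<longleftrightarrow>
     (\<exists>\<epsilon>>0. \<forall>x\<in>X. \<forall>y\<in>X. x \<noteq> y \<longrightarrow>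
        (\<exists>g\<in>carrier G. \<phi> g x \<in> X \<and> \<phi> g y \<in> X \<and> d (\<phi> g x) (\<phi> g y) > \<epsilon>))"

definition transformation_basis ::
  "('g, 'm) monoid_scheme \<Rightarrow> 'y topology \<Rightarrow> ('g \<Rightarrow> 'y \<Rightarrow> 'y) \<Rightarrow> 'y set \<Rightarrow> ('g \<times> 'y) set set" where
  "transformation_basis G Y \<phi> X =
     {{g} \<times> W | g W. g \<in> carrier G \<and> openin (subtopology Y X) W \<and> \<phi> g ` W \<subseteq> X}"

definition transformation_groupoid ::
  "('g, 'm) monoid_scheme \<Rightarrow> 'y topology \<Rightarrow> ('g \<Rightarrow> 'y \<Rightarrow> 'y) \<Rightarrow> 'y set \<Rightarrow> ('y, 'g \<times> 'y) groupoid" where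
  "transformation_groupoid G Y \<phi> X =
    \<lparr> units = subtopology Y X,
      arrows = topology (arbitrary union_of (\<lambda>U. U \<in> transformation_basis G Y \<phi> X)),
      src = (\<lambda>(g, x). x),
      rng = (\<lambda>(g, x). \<phi> g x),
      gid = (\<lambda>x. (\<one>\<^bsub>G\<^esub>, x)),
      gmult = (\<lambda>(g, y) (h, x). (g \<otimes>\<^bsub>G\<^esub> h, x)),
      ginv = (\<lambda>(g, x). (inv\<^bsub>G\<^esub> g, \<phi> g x)) \<rparr>"

text \<open>The family of sets used above is indeed a basis of a topology, and the resulting space has
  the expected underlying set.\<close>

context partial_action
begin

lemma transformation_basis:
  "is_basis (arrows (transformation_groupoid G Y \<phi> X)) (transformation_basis G Y \<phi> X)"
proof -
  have "S \<inter> T \<in> transformation_basis G Y \<phi> X"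
    if S: "S \<in> transformation_basis G Y \<phi> X" and T: "T \<in> transformation_basis G Y \<phi> X" for S T
  proof -
    obtain g V where g: "S = {g} \<times> V" "g \<in> carrier G" "openin (subtopology Y X) V" "\<phi> g ` V \<subseteq> X"
      using S by (auto simp: transformation_basis_def)
    obtain h W where h: "T = {h} \<times> W" "openin (subtopology Y X) W"
      using T by (auto simp: transformation_basis_def)
    have "S \<inter> T = {g} \<times> (if g = h then V \<inter> W else {})"
      using g h by auto
    moreover have "openin (subtopology Y X) (if g = h then V \<inter> W else {})"
      using g h by auto
    moreover have "\<phi> g ` (if g = h then V \<inter> W else {}) \<subseteq> X"
      using g by auto
    ultimately show ?thesis
      using g(2) unfolding transformation_basis_def by blast
  qed
  then have "istopology (arbitrary union_of (\<lambda>U. U \<in> transformation_basis G Y \<phi> X))"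
    by (intro istopology_base)
  then show ?thesis
    by (simp add: is_basis_def transformation_groupoid_def topology_inverse')
qed

lemma topspace_arrows:
  "topspace (arrows (transformation_groupoid G Y \<phi> X)) = {(g, x). g \<in> carrier G \<and> x \<in> X \<and> \<phi> g x \<in> X}"
proof -
  have *: "openin (arrows (transformation_groupoid G Y \<phi> X)) =
      arbitrary union_of (\<lambda>U. U \<in> transformation_basis G Y \<phi> X)"
    using transformation_basis by (simp add: is_basis_def)
  have "topspace (arrows (transformation_groupoid G Y \<phi> X)) = \<Union>(transformation_basis G Y \<phi> X)"
    unfolding topspace_def * by (auto simp: union_of_def arbitrary_def)
  also have "\<dots> = {(g, x). g \<in> carrier G \<and> x \<in> X \<and> \<phi> g x \<in> X}"
  proof (intro equalityI subsetI)
    fix p assume "p \<in> \<Union>(transformation_basis G Y \<phi> X)"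
    then show "p \<in> {(g, x). g \<in> carrier G \<and> x \<in> X \<and> \<phi> g x \<in> X}"
      by (fastforce simp: transformation_basis_def dest: openin_imp_subset)
  next
    fix p assume "p \<in> {(g, x). g \<in> carrier G \<and> x \<in> X \<and> \<phi> g x \<in> X}"
    then obtain g x where p: "p = (g, x)" "g \<in> carrier G" "x \<in> X" "\<phi> g x \<in> X" by auto
    let ?W = "{x \<in> topspace Y. \<phi> g x \<in> X} \<inter> X"
    have "openin Y {x \<in> topspace Y. \<phi> g x \<in> X}"
      using openin_continuous_map_preimage[OF homeomorphic_imp_continuous_map[OF homeo[OF p(2)]] open_X] .
    then have "openin (subtopology Y X) ?W"
      by (auto simp: openin_subtopology)
    then have "{g} \<times> ?W \<in> transformation_basis G Y \<phi> X"
      using p by (auto simp: transformation_basis_def)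
    moreover have "p \<in> {g} \<times> ?W"
      using p open_X openin_subset by auto
    ultimately show "p \<in> \<Union>(transformation_basis G Y \<phi> X)" by blast
  qed
  finally show ?thesis .
qed

end

end

theory Submission
  imports Defs
begin

text \<open>Arrows are pairs (g, x), and a slice {g} x W with W compact open is a bisection;
  products and inverses of such slices are again such slices. Compact generation gives a compact K,
  covered by finitely many of them. To this cover are added the unit slices {1} x D, where D runs
  over a finite cover of X by compact open sets of diameter below the expansivity constant. The set
  K is kept; only its cover grows.

  Let F be the family of finite products of the cover and its inverses. Its members are open and,
  because K generates, every arrow lies in some member. Small members around units come from
  expansivity: if x and y differ, some g moves them more than \<epsilon> apart, so a D that contains
  gx misses gy. Multiplying a member through (inv g, gx), the slice {1} x D and a member through (g,
  x) gives a {1} x V in F with x in V and y outside V. Such V are closed in X, so compactness of the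
  complement of a neighbourhood W of x yields finitely many of them that intersect inside W, and
  intersecting the V amounts to multiplying the slices. Finally, a member through (g, x) times a
  small {1} x V fits into any prescribed neighbourhood of (g, x).

  \<open>set_pow_Union\<close> turns generation into covering, \<open>set_mult_slices\<close> keeps
  products compact open, \<open>is_basis_family_pow\<close> holds the separation and compactness
  argument, and \<open>compact_open_cover_small\<close> supplies the sets D.\<close>

section \<open>Cantor spaces and injective restrictions of open maps\<close>

lemma cantor_space_imp_compact_space:
  assumes "cantor_space Z"
  shows "compact_space Z"
proof -
  have "compact_space (product_topology (\<lambda>_. discrete_topology (UNIV :: bool set)) (UNIV :: nat set))"
    by (simp add: compact_space_product_topology compact_space_discrete_topology)
  then show ?thesis
    using assms homeomorphic_compact_space unfolding cantor_space_def by blast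
qed

text \<open>Cylinder sets of a product of discrete spaces are open because only finitely many
  coordinates are restricted, and closed because every factor is closed. The homeomorphism pulls
  them back to \<open>Z\<close>.\<close>

lemma cantor_space_clopen_neighbourhood:
  assumes Z: "cantor_space Z" and U: "openin Z U" and x: "x \<in> U"
  obtains V where "openin Z V" "closedin Z V" "x \<in> V" "V \<subseteq> U"
proof -
  let ?C = "product_topology (\<lambda>_. discrete_topology (UNIV :: bool set)) (UNIV :: nat set)"
  obtain f where f: "homeomorphic_map Z ?C f"
    using Z unfolding cantor_space_def homeomorphic_space by blast
  have sub: "U \<subseteq> topspace Z" using U openin_subset by blast
  have "openin ?C (f ` U)"
    using homeomorphic_map_openness[OF f sub] U by blast
  then obtain W where W: "finite {i \<in> UNIV. W i \<noteq> topspace (discrete_topology (UNIV :: bool set))}"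
      "f x \<in> Pi\<^sub>E UNIV W" "Pi\<^sub>E UNIV W \<subseteq> f ` U"
    using x unfolding openin_product_topology_alt by blast
  have op: "openin ?C (Pi\<^sub>E UNIV W)"
    using W(1) by (auto simp: openin_PiE_gen)
  have cl: "closedin ?C (Pi\<^sub>E UNIV W)"
    by (simp add: closedin_product_topology)
  define V where "V = {z \<in> topspace Z. f z \<in> Pi\<^sub>E UNIV W}"
  have cont: "continuous_map Z ?C f" and inj: "inj_on f (topspace Z)"
    using f by (auto simp: homeomorphic_eq_everything_map)
  show thesis
  proof
    show "openin Z V" "closedin Z V"
      unfolding V_def
      using openin_continuous_map_preimage[OF cont op] closedin_continuous_map_preimage[OF cont cl] .
    show "x \<in> V"
      using x sub W(2) by (auto simp: V_def)
    show "V \<subseteq> U"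
    proof
      fix z assume "z \<in> V"
      then obtain u where "z \<in> topspace Z" "u \<in> U" "f z = f u"
        using W(3) by (auto simp: V_def)
      then show "z \<in> U"
        using inj sub by (metis inj_onD subsetD)
    qed
  qed
qed

text \<open>Leaves only injectivity to check for bisections once source and range are known to be
  continuous and open on the whole arrow space.\<close>

lemma homeo_onto_open_of_open_map:
  assumes f: "continuous_map A X f" "open_map A X f" and S: "openin A S" and inj: "inj_on f S"
  shows "homeo_onto_open A X f S"
proof -
  have sub: "S \<subseteq> topspace A" using S openin_subset by blast
  have img: "openin X (f ` S)" using f(2) S by (auto simp: open_map_def)
  have "open_map (subtopology A S) (subtopology X (f ` S)) f"
    using open_map_from_subtopology[OF f(2) S] by (simp add: open_map_into_subtopology)
  moreover have "continuous_map (subtopology A S) (subtopology X (f ` S)) f"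
    using f(1) by (auto simp: continuous_map_in_subtopology continuous_map_from_subtopology)
  ultimately have "homeomorphic_map (subtopology A S) (subtopology X (f ` S)) f"
    using sub inj openin_subset[OF img]
    by (intro bijective_open_imp_homeomorphic_map) (auto simp: inf.absorb2)
  then show ?thesis using img by (simp add: homeo_onto_open_def)
qed

section \<open>Products of sets in a groupoid\<close>

lemma set_mult_mono: "A \<subseteq> A' \<Longrightarrow> B \<subseteq> B' \<Longrightarrow> set_mult \<G> A B \<subseteq> set_mult \<G> A' B'"
  by (auto simp: set_mult_def)

lemma set_pow_mono: "S \<subseteq> T \<Longrightarrow> set_pow \<G> S n \<subseteq> set_pow \<G> T n"
  by (induction n) (simp_all add: set_mult_mono)

text \<open>Set products distribute over unions. This is how generation by a set becomes covering by
  products of members of a family.\<close>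

lemma set_pow_Union: "set_pow \<G> (\<Union>\<S>) n = \<Union>(family_pow \<G> \<S> n)"
proof (induction n)
  case (Suc n)
  show ?case
    unfolding set_pow.simps Suc family_pow.simps by (auto simp: set_mult_def; blast)
qed simp

context topological_groupoid
begin

lemma gmult_closed:
  assumes "(a, b) \<in> composable \<G>"
  shows "gmult \<G> a b \<in> topspace (arrows \<G>)"
proof -
  have "(a, b) \<in> topspace (subtopology (prod_topology (arrows \<G>) (arrows \<G>)) (composable \<G>))"
    using assms by (auto simp: composable_def)
  then show ?thesis
    using continuous_map_image_subset_topspace[OF continuous_gmult] by force
qed

lemma set_mult_assoc:
  assumes "A \<subseteq> topspace (arrows \<G>)" "B \<subseteq> topspace (arrows \<G>)" "C \<subseteq> topspace (arrows \<G>)"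
  shows "set_mult \<G> (set_mult \<G> A B) C = set_mult \<G> A (set_mult \<G> B C)" (is "?L = ?R")
proof
  show "?L \<subseteq> ?R"
  proof
    fix p assume "p \<in> ?L"
    then obtain a b c where abc: "p = gmult \<G> (gmult \<G> a b) c" "a \<in> A" "b \<in> B" "c \<in> C"
        "src \<G> a = rng \<G> b" "src \<G> (gmult \<G> a b) = rng \<G> c"
      by (auto simp: set_mult_def)
    have ab: "(a, b) \<in> composable \<G>" using abc assms by (auto simp: composable_def)
    then have bc: "(b, c) \<in> composable \<G>"
      using abc assms src_mult[OF ab] by (auto simp: composable_def)
    have "p = gmult \<G> a (gmult \<G> b c)" "src \<G> b = rng \<G> c" "src \<G> a = rng \<G> (gmult \<G> b c)"
      using abc mult_assoc[OF ab bc] rng_mult[OF bc] src_mult[OF ab] by auto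
    then show "p \<in> ?R" using abc unfolding set_mult_def by blast
  qed
  show "?R \<subseteq> ?L"
  proof
    fix p assume "p \<in> ?R"
    then obtain a b c where abc: "p = gmult \<G> a (gmult \<G> b c)" "a \<in> A" "b \<in> B" "c \<in> C"
        "src \<G> a = rng \<G> (gmult \<G> b c)" "src \<G> b = rng \<G> c"
      by (auto simp: set_mult_def)
    have bc: "(b, c) \<in> composable \<G>" using abc assms by (auto simp: composable_def)
    then have ab: "(a, b) \<in> composable \<G>"
      using abc assms rng_mult[OF bc] by (auto simp: composable_def)
    have "p = gmult \<G> (gmult \<G> a b) c" "src \<G> a = rng \<G> b" "src \<G> (gmult \<G> a b) = rng \<G> c"
      using abc mult_assoc[OF ab bc] rng_mult[OF bc] src_mult[OF ab] by auto
    then show "p \<in> ?L" using abc unfolding set_mult_def by blast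
  qed
qed

lemma set_mult_closed:
  assumes "A \<subseteq> topspace (arrows \<G>)" "B \<subseteq> topspace (arrows \<G>)"
  shows "set_mult \<G> A B \<subseteq> topspace (arrows \<G>)"
  using assms gmult_closed by (fastforce simp: set_mult_def composable_def)

lemma family_pow_closed:
  assumes "\<Union>\<S> \<subseteq> topspace (arrows \<G>)" "A \<in> family_pow \<G> \<S> n"
  shows "A \<subseteq> topspace (arrows \<G>)"
  using assms(2)
proof (induction n arbitrary: A)
  case (Suc n)
  then obtain B C where "A = set_mult \<G> B C" "B \<in> \<S>" "C \<in> family_pow \<G> \<S> n" by auto
  then show ?case
    using set_mult_closed[of B C] Suc.IH assms(1) by blast
qed (use assms in auto)

text \<open>\<open>family_pow\<close> only multiplies on the left, so associativity does the
  rebracketing. Exponents are shifted by one: m+1 factors times n+1 factors have index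
  m+n+1.\<close>

lemma family_pow_mult:
  assumes \<S>: "\<Union>\<S> \<subseteq> topspace (arrows \<G>)"
    and A: "A \<in> family_pow \<G> \<S> m" and B: "B \<in> family_pow \<G> \<S> n"
  shows "set_mult \<G> A B \<in> family_pow \<G> \<S> (m + n + 1)"
  using A
proof (induction m arbitrary: A)
  case 0
  then show ?case using B by auto
next
  case (Suc m)
  then obtain C D where A: "A = set_mult \<G> C D" and C: "C \<in> \<S>" and D: "D \<in> family_pow \<G> \<S> m"
    by auto
  have "set_mult \<G> A B = set_mult \<G> C (set_mult \<G> D B)"
    unfolding A using C family_pow_closed[OF \<S>] D B \<S> by (intro set_mult_assoc) blast+
  then show ?case using Suc.IH[OF D] C by auto
qed

end

section \<open>The transformation groupoid\<close>

context partial_action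
begin

abbreviation "transf \<equiv> transformation_groupoid G Y \<phi> X"

lemma group_G: "group G"
  using group_hom group_hom.axioms(1) by blast

lemma X_subset: "X \<subseteq> topspace Y"
  using open_X openin_subset by blast

lemma openin_X_iff: "openin (subtopology Y X) W \<longleftrightarrow> openin Y W \<and> W \<subseteq> X"
  using openin_open_subtopology[OF open_X] by blast

lemma act_one: "x \<in> topspace Y \<Longrightarrow> \<phi> \<one> x = x"
  by (metis id_eq_one restrict_apply')

lemma act_inv: "g \<in> carrier G \<Longrightarrow> x \<in> topspace Y \<Longrightarrow> \<phi> (inv g) (\<phi> g x) = x"
  using orbit_sym_aux by blast

lemma openin_preimage:
  "g \<in> carrier G \<Longrightarrow> openin Y U \<Longrightarrow> openin Y {x \<in> topspace Y. \<phi> g x \<in> U}"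
  using openin_continuous_map_preimage[OF homeomorphic_imp_continuous_map[OF homeo]] .

lemma openin_image: "g \<in> carrier G \<Longrightarrow> openin Y U \<Longrightarrow> openin Y (\<phi> g ` U)"
  using homeomorphic_imp_open_map[OF homeo] by (auto simp: open_map_def)

lemma transf_sel [simp]:
  "units transf = subtopology Y X" "src transf (g, x) = x" "rng transf (g, x) = \<phi> g x"
  "gid transf x = (\<one>, x)" "gmult transf (g, y) (h, x) = (g \<otimes> h, x)"
  "ginv transf (g, x) = (inv g, \<phi> g x)"
  by (simp_all add: transformation_groupoid_def)

text \<open>The arrow space is a disjoint union, over the discrete group, of the domains of the
  partial maps, so openness is tested one group element at a time. As X is open in Y, the test can
  be made in Y. The continuity proofs for the structure maps rest on this.\<close>

lemma openin_arrows:
  "openin (arrows transf) U \<longleftrightarrow>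
     U \<subseteq> topspace (arrows transf) \<and> (\<forall>g\<in>carrier G. openin Y {x. (g, x) \<in> U})" (is "?L \<longleftrightarrow> ?R")
proof
  assume L: ?L
  have "openin Y {x. (g, x) \<in> U}" if g: "g \<in> carrier G" for g
  proof (subst openin_subopen, intro ballI)
    fix x assume "x \<in> {x. (g, x) \<in> U}"
    then obtain B where "B \<in> transformation_basis G Y \<phi> X" "(g, x) \<in> B" "B \<subseteq> U"
      using L transformation_basis unfolding is_basis_def openin_topology_base_unique by blast
    then show "\<exists>T. openin Y T \<and> x \<in> T \<and> T \<subseteq> {x. (g, x) \<in> U}"
      by (fastforce simp: transformation_basis_def openin_X_iff)
  qed
  then show ?R using L openin_subset by blast
next
  assume R: ?R
  show ?L
  proof (subst openin_subopen, intro ballI)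
    fix p assume p: "p \<in> U"
    obtain g x where gx: "p = (g, x)" "g \<in> carrier G"
      using p R by (auto simp: topspace_arrows)
    let ?B = "{g} \<times> {x. (g, x) \<in> U}"
    have "openin Y {x. (g, x) \<in> U}" using R gx(2) by blast
    moreover have "{x. (g, x) \<in> U} \<subseteq> X" "\<phi> g ` {x. (g, x) \<in> U} \<subseteq> X"
      using R by (auto simp: topspace_arrows)
    ultimately have "?B \<in> transformation_basis G Y \<phi> X"
      using gx(2) unfolding transformation_basis_def openin_X_iff by blast
    then have "openin (arrows transf) ?B"
      using transformation_basis unfolding is_basis_def openin_topology_base_unique by blast
    then show "\<exists>T. openin (arrows transf) T \<and> p \<in> T \<and> T \<subseteq> U"
      using p gx by (intro exI[of _ ?B]) auto
  qed
qed

lemma openin_slice: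
  assumes "g \<in> carrier G" "openin Y W" "W \<subseteq> X" "\<phi> g ` W \<subseteq> X"
  shows "openin (arrows transf) ({g} \<times> W)"
proof -
  have "{x. (h, x) \<in> {g} \<times> W} = (if h = g then W else {})" for h by auto
  then show ?thesis
    unfolding openin_arrows topspace_arrows using assms by auto
qed

section \<open>Continuity of the structure maps and the etale groupoid axioms\<close>

lemma continuous_map_src: "continuous_map (arrows transf) (subtopology Y X) (src transf)"
proof -
  have "openin (arrows transf) {a \<in> topspace (arrows transf). src transf a \<in> U}"
    if U: "openin Y U" "U \<subseteq> X" for U
  proof -
    have "{x. (g, x) \<in> {a \<in> topspace (arrows transf). src transf a \<in> U}} =
        U \<inter> {x \<in> topspace Y. \<phi> g x \<in> X}" if "g \<in> carrier G" for g
      using U X_subset that by (auto simp: topspace_arrows)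
    then show ?thesis
      using openin_preimage[OF _ open_X] U(1) by (auto simp: openin_arrows)
  qed
  then show ?thesis
    using X_subset by (auto simp: continuous_map openin_X_iff topspace_arrows)
qed

lemma continuous_map_rng: "continuous_map (arrows transf) (subtopology Y X) (rng transf)"
proof -
  have "openin (arrows transf) {a \<in> topspace (arrows transf). rng transf a \<in> U}"
    if U: "openin Y U" "U \<subseteq> X" for U
  proof -
    have "{x. (g, x) \<in> {a \<in> topspace (arrows transf). rng transf a \<in> U}} =
        X \<inter> {x \<in> topspace Y. \<phi> g x \<in> U}" if "g \<in> carrier G" for g
      using U X_subset that by (auto simp: topspace_arrows)
    then show ?thesis
      using openin_preimage U(1) open_X by (auto simp: openin_arrows)
  qed
  then show ?thesis
    using X_subset by (auto simp: continuous_map openin_X_iff topspace_arrows)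
qed

lemma open_map_src: "open_map (arrows transf) (subtopology Y X) (src transf)"
  unfolding open_map_def
proof (intro allI impI)
  fix U assume U: "openin (arrows transf) U"
  then have sub: "U \<subseteq> topspace (arrows transf)" using openin_subset by blast
  then have "src transf ` U = (\<Union>g\<in>carrier G. {x. (g, x) \<in> U})"
    by (force simp: topspace_arrows image_iff)
  moreover have "src transf ` U \<subseteq> X" using sub by (auto simp: topspace_arrows)
  ultimately show "openin (subtopology Y X) (src transf ` U)"
    using U by (auto simp: openin_X_iff openin_arrows)
qed

lemma open_map_rng: "open_map (arrows transf) (subtopology Y X) (rng transf)"
  unfolding open_map_def
proof (intro allI impI)
  fix U assume U: "openin (arrows transf) U"
  then have sub: "U \<subseteq> topspace (arrows transf)" using openin_subset by blast
  then have "rng transf ` U = (\<Union>g\<in>carrier G. \<phi> g ` {x. (g, x) \<in> U})"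
    by (force simp: topspace_arrows image_iff)
  moreover have "rng transf ` U \<subseteq> X" using sub by (auto simp: topspace_arrows)
  ultimately show "openin (subtopology Y X) (rng transf ` U)"
    using U openin_image by (auto simp: openin_X_iff openin_arrows)
qed

text \<open>The group element is constant on a slice, so the source is injective there, and the
  range is injective because \<open>\<phi> g\<close> is.\<close>

lemma bisection_slice:
  assumes "g \<in> carrier G" "openin Y W" "W \<subseteq> X" "\<phi> g ` W \<subseteq> X"
  shows "bisection transf ({g} \<times> W)"
proof -
  have "inj_on (src transf) ({g} \<times> W)" by (auto simp: inj_on_def)
  moreover have "inj_on (rng transf) ({g} \<times> W)"
    using inj_prop[OF assms(1)] assms(3) X_subset by (auto simp: inj_on_def)
  ultimately show ?thesis
    using openin_slice[OF assms] continuous_map_src open_map_src continuous_map_rng open_map_rng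
    by (simp add: bisection_def homeo_onto_open_of_open_map)
qed

lemma continuous_map_ginv: "continuous_map (arrows transf) (arrows transf) (ginv transf)"
proof -
  interpret G: group G by (rule group_G)
  have closed: "ginv transf a \<in> topspace (arrows transf)" if "a \<in> topspace (arrows transf)" for a
    using that X_subset by (auto simp: topspace_arrows act_inv subset_iff)
  have "openin (arrows transf) {a \<in> topspace (arrows transf). ginv transf a \<in> U}"
    if U: "openin (arrows transf) U" for U
  proof -
    have "{x. (g, x) \<in> {a \<in> topspace (arrows transf). ginv transf a \<in> U}} =
        X \<inter> {x \<in> topspace Y. \<phi> g x \<in> {y. (inv g, y) \<in> U}}" if "g \<in> carrier G" for g
      using openin_subset[OF U] X_subset that by (auto simp: topspace_arrows)
    moreover have "openin Y (X \<inter> {x \<in> topspace Y. \<phi> g x \<in> {y. (inv g, y) \<in> U}})"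
      if "g \<in> carrier G" for g
      using that U open_X openin_preimage[OF that, of "{y. (inv g, y) \<in> U}"]
      unfolding openin_arrows[of U] by (intro openin_Int) blast+
    ultimately show ?thesis
      unfolding openin_arrows[of "Collect _"] by auto
  qed
  then show ?thesis
    using closed by (auto simp: continuous_map simp del: transf_sel)
qed

lemma continuous_map_gid: "continuous_map (subtopology Y X) (arrows transf) (gid transf)"
proof -
  interpret G: group G by (rule group_G)
  have "openin (subtopology Y X) {x \<in> topspace (subtopology Y X). gid transf x \<in> U}"
    if U: "openin (arrows transf) U" for U
  proof -
    have "{x \<in> topspace (subtopology Y X). gid transf x \<in> U} = {x. (\<one>, x) \<in> U}"
      using openin_subset[OF U] X_subset by (auto simp: topspace_arrows)
    moreover have "{x. (\<one>, x) \<in> U} \<subseteq> X"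
      using openin_subset[OF U] by (auto simp: topspace_arrows)
    ultimately show ?thesis
      using U by (auto simp: openin_arrows openin_X_iff)
  qed
  then show ?thesis
    using X_subset by (auto simp: continuous_map topspace_arrows act_one subset_iff)
qed

lemma composable_transf:
  "composable transf = {((g, y), (h, x)). g \<in> carrier G \<and> h \<in> carrier G \<and> x \<in> X \<and>
     y = \<phi> h x \<and> \<phi> h x \<in> X \<and> \<phi> (g \<otimes> h) x \<in> X}"
proof -
  have "\<phi> (g \<otimes> h) x = \<phi> g (\<phi> h x)" if "g \<in> carrier G" "h \<in> carrier G" "x \<in> X" for g h x
    using composition_rule[of x g h] that X_subset by blast
  then show ?thesis
    by (auto simp: composable_def topspace_arrows)
qed

text \<open>Slices are open, so both group elements may be fixed near a composable pair. The product
  is then (gh, x), which depends only on the right factor; hence the condition from \<open>U\<close>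
  restricts \<open>?B\<close> alone.\<close>

lemma continuous_map_gmult:
  "continuous_map (subtopology (prod_topology (arrows transf) (arrows transf)) (composable transf))
     (arrows transf) (\<lambda>(a, b). gmult transf a b)"
proof -
  interpret G: group G by (rule group_G)
  let ?P = "prod_topology (arrows transf) (arrows transf)"
  have "openin (subtopology ?P (composable transf))
      {p \<in> topspace (subtopology ?P (composable transf)). (\<lambda>(a, b). gmult transf a b) p \<in> U}"
    (is "openin _ ?S") if U: "openin (arrows transf) U" for U
  proof (subst openin_subopen, intro ballI)
    fix p assume p: "p \<in> ?S"
    then obtain g h x where ghx: "p = ((g, \<phi> h x), (h, x))" "g \<in> carrier G" "h \<in> carrier G"
        "(g \<otimes> h, x) \<in> U" and c: "p \<in> composable transf"
      by (auto simp: composable_transf)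
    let ?A = "{g} \<times> (X \<inter> {y \<in> topspace Y. \<phi> g y \<in> X})"
    let ?B = "{h} \<times> (({x. (g \<otimes> h, x) \<in> U} \<inter> X) \<inter> {y \<in> topspace Y. \<phi> h y \<in> X})"
    have "openin Y {x. (g \<otimes> h, x) \<in> U}"
      using U ghx(2,3) unfolding openin_arrows by blast
    then have "openin (arrows transf) ?A" "openin (arrows transf) ?B"
      using ghx openin_preimage[OF _ open_X] open_X by (auto intro!: openin_slice openin_Int)
    then have "openin (subtopology ?P (composable transf)) (?A \<times> ?B \<inter> composable transf)"
      by (simp add: openin_subtopology_Int openin_prod_Times_iff)
    moreover have "p \<in> ?A \<times> ?B \<inter> composable transf"
      using c ghx X_subset by (auto simp: composable_def topspace_arrows)
    moreover have "?A \<times> ?B \<inter> composable transf \<subseteq> ?S"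
      by (auto simp: composable_def)
    ultimately show "\<exists>T. openin (subtopology ?P (composable transf)) T \<and> p \<in> T \<and> T \<subseteq> ?S"
      by blast
  qed
  moreover have "gmult transf a b \<in> topspace (arrows transf)" if "(a, b) \<in> composable transf" for a b
    using that by (auto simp: composable_transf topspace_arrows)
  ultimately show ?thesis
    by (auto simp: continuous_map simp del: transf_sel)
qed

lemma etale_groupoid_transf: "etale_groupoid transf"
proof -
  interpret G: group G by (rule group_G)
  have loc: "\<exists>U. openin (arrows transf) U \<and> a \<in> U \<and>
      homeo_onto_open (arrows transf) (units transf) (src transf) U"
    if "a \<in> topspace (arrows transf)" for a
  proof -
    obtain g x where a: "a = (g, x)" "g \<in> carrier G" "x \<in> X" "\<phi> g x \<in> X"
      using \<open>a \<in> topspace (arrows transf)\<close> by (auto simp: topspace_arrows)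
    let ?W = "X \<inter> {x \<in> topspace Y. \<phi> g x \<in> X}"
    have "openin Y ?W" using open_X openin_preimage[OF a(2) open_X] by auto
    then have "bisection transf ({g} \<times> ?W)"
      using a by (intro bisection_slice) auto
    moreover have "a \<in> {g} \<times> ?W" using a X_subset by auto
    ultimately show ?thesis unfolding bisection_def by blast
  qed
  show ?thesis
  proof unfold_locales
    show "continuous_map (subtopology (prod_topology (arrows transf) (arrows transf)) (composable transf))
     (arrows transf) (\<lambda>(a, b). gmult transf a b)" by (rule continuous_map_gmult)
    show "continuous_map (arrows transf) (units transf) (src transf)"
      using continuous_map_src by simp
    show "continuous_map (arrows transf) (units transf) (rng transf)"
      using continuous_map_rng by simp
    show "continuous_map (units transf) (arrows transf) (gid transf)"
      using continuous_map_gid by simp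
    show "\<exists>U. openin (arrows transf) U \<and> a \<in> U \<and>
      homeo_onto_open (arrows transf) (units transf) (src transf) U"
      if "a \<in> topspace (arrows transf)" for a using loc that .
  qed (use X_subset continuous_map_ginv in
      \<open>auto simp: composable_transf topspace_arrows act_one act_inv G.m_assoc subset_iff
            composition_rule\<close>)
qed

section \<open>Compact open slices and the basis criterion\<close>

text \<open>Compactness in Y is carried along by homeomorphisms of Y, which closedness in X is not
  by itself; in a Hausdorff X it gives closedness back.\<close>

definition compact_open where
  "compact_open W \<longleftrightarrow> openin Y W \<and> compactin Y W \<and> W \<subseteq> X"

definition slices where
  "slices = {{g} \<times> W | g W. g \<in> carrier G \<and> compact_open W \<and> \<phi> g ` W \<subseteq> X}"

lemma compact_open_image:
  assumes "compact_open W" "g \<in> carrier G" "\<phi> g ` W \<subseteq> X"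
  shows "compact_open (\<phi> g ` W)"
  using assms openin_image[of g W]
    image_compactin[OF _ homeomorphic_imp_continuous_map[OF homeo[OF assms(2)]], of W]
  by (simp add: compact_open_def)

text \<open>Y may fail to be Hausdorff, so the intersection is formed inside X, where compact sets
  are closed.\<close>

lemma compact_open_Int:
  assumes "Hausdorff_space (subtopology Y X)" "compact_open V" "compact_open W"
  shows "compact_open (V \<inter> W)"
proof -
  have "compactin (subtopology Y X) V" "compactin (subtopology Y X) W"
    using assms by (auto simp: compact_open_def compactin_subtopology)
  then have "compactin (subtopology Y X) (V \<inter> W)"
    using assms(1) by (simp add: compact_Int_closedin compactin_imp_closedin)
  then show ?thesis
    using assms by (auto simp: compact_open_def compactin_subtopology)
qed

lemma set_mult_slice: "set_mult transf ({g} \<times> A) ({h} \<times> B) = {g \<otimes> h} \<times> {x \<in> B. \<phi> h x \<in> A}"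
  by (auto simp: set_mult_def)

lemma ginv_slice: "ginv transf ` ({g} \<times> W) = {inv g} \<times> \<phi> g ` W"
  by (force simp: image_iff)

lemma compact_open_slice:
  assumes "{g} \<times> V \<in> slices"
  shows "compact_open V"
\<comment> \<open>An empty slice does not determine its group element, so
  \<open>times_eq_iff\<close> identifies the factors only in the nonempty case.\<close>
proof (cases "V = {}")
  case True
  then show ?thesis by (simp add: compact_open_def)
next
  case False
  then show ?thesis using assms by (auto simp: slices_def times_eq_iff)
qed

lemma slices_closed: "\<Union>slices \<subseteq> topspace (arrows transf)"
  by (auto simp: slices_def compact_open_def topspace_arrows)

lemma openin_slices: "S \<in> slices \<Longrightarrow> openin (arrows transf) S"
  using openin_slice by (auto simp: slices_def compact_open_def)

lemma bisection_slices: "S \<in> slices \<Longrightarrow> bisection transf S"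
  using bisection_slice by (auto simp: slices_def compact_open_def)

lemma ginv_slices:
  assumes "S \<in> slices"
  shows "ginv transf ` S \<in> slices"
proof -
  obtain g W where S: "S = {g} \<times> W" "g \<in> carrier G" "compact_open W" "\<phi> g ` W \<subseteq> X"
    using assms by (auto simp: slices_def)
  have "\<phi> (inv g) ` \<phi> g ` W = W"
    using S X_subset by (auto simp: image_image compact_open_def act_inv subset_iff)
  moreover have "W \<subseteq> X" using S(3) by (simp add: compact_open_def)
  ultimately show ?thesis
    using S compact_open_image[of W g] group.inv_closed[OF group_G, of g]
    unfolding slices_def S(1) ginv_slice by blast
qed

text \<open>The domain of the product is the translate by \<open>inv h\<close> of the intersection
  of hB and A, hence compact open; Hausdorffness enters through that intersection.\<close>

lemma set_mult_slices:
  assumes H: "Hausdorff_space (subtopology Y X)" and "S \<in> slices" "T \<in> slices"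
  shows "set_mult transf S T \<in> slices"
proof -
  obtain g A h B where
      S: "S = {g} \<times> A" "g \<in> carrier G" "compact_open A" "\<phi> g ` A \<subseteq> X"
      and T: "T = {h} \<times> B" "h \<in> carrier G" "compact_open B" "\<phi> h ` B \<subseteq> X"
    using assms by (auto simp: slices_def)
  interpret G: group G by (rule group_G)
  let ?C = "{x \<in> B. \<phi> h x \<in> A}"
  have sub: "?C \<subseteq> topspace Y" "A \<subseteq> X" "B \<subseteq> X"
    using T S X_subset by (auto simp: compact_open_def)
  have "?C = \<phi> (inv h) ` (\<phi> h ` B \<inter> A)"
    using act_inv[OF T(2)] sub X_subset by (force simp: image_iff)
  moreover have "compact_open (\<phi> h ` B \<inter> A)"
    using compact_open_Int[OF H] compact_open_image S T by blast
  moreover have "?C \<subseteq> X" using sub by auto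
  ultimately have "compact_open ?C"
    using compact_open_image[of "\<phi> h ` B \<inter> A" "inv h"] T(2) by simp
  moreover have "\<phi> (g \<otimes> h) ` ?C \<subseteq> X"
    using S T sub composition_rule by (auto simp: subset_iff)
  ultimately show ?thesis
    unfolding S(1) T(1) set_mult_slice slices_def using S(2) T(2) by blast
qed

lemma family_pow_slices:
  assumes "Hausdorff_space (subtopology Y X)" "\<S> \<subseteq> slices"
  shows "family_pow transf \<S> n \<subseteq> slices"
proof (induction n)
  case (Suc n)
  then show ?case using assms set_mult_slices by (auto simp: subset_iff)
qed (use assms in simp)

text \<open>The products of the form \<open>{\<one>} \<times> V\<close> separate points: if no member of \<open>\<D>\<close> contains both \<open>g x\<close>
  and \<open>g y\<close>, take \<open>D \<in> \<D>\<close> containing \<open>g x\<close> and conjugate \<open>{\<one>} \<times> D\<close> by products around \<open>(g, x)\<close> and its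
  inverse; the resulting \<open>V\<close> contains \<open>x\<close> but not \<open>y\<close>.  By compactness, finitely many such \<open>V\<close>
  intersect inside a given neighbourhood of \<open>x\<close>.  Since \<open>Y\<close> need not be Hausdorff, the sets \<open>V\<close> are
  kept compact open, which makes them closed in \<open>X\<close> though \<open>X\<close> itself may fail to be closed in \<open>Y\<close>.\<close>

lemma is_basis_family_pow:
  fixes \<S> and \<D>
  defines "\<F> \<equiv> \<Union>n. family_pow transf \<S> n"
  assumes comp: "compact_space (subtopology Y X)" and H: "Hausdorff_space (subtopology Y X)"
    and \<S>: "\<S> \<subseteq> slices" and gen: "topspace (arrows transf) \<subseteq> \<Union>\<F>"
    and \<D>: "X \<subseteq> \<Union>\<D>" "\<And>D. D \<in> \<D> \<Longrightarrow> {\<one>} \<times> D \<in> \<S>"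
    and sep: "\<And>x y. x \<in> X \<Longrightarrow> y \<in> X \<Longrightarrow> x \<noteq> y \<Longrightarrow>
      \<exists>g\<in>carrier G. \<phi> g x \<in> X \<and> \<phi> g y \<in> X \<and> (\<forall>D\<in>\<D>. \<phi> g x \<in> D \<longrightarrow> \<phi> g y \<notin> D)"
  shows "is_basis (arrows transf) \<F>"
proof -
  interpret G: group G by (rule group_G)
  interpret E: etale_groupoid transf by (rule etale_groupoid_transf)
  have \<F>_slices: "\<F> \<subseteq> slices"
    using family_pow_slices[OF H \<S>] by (auto simp: \<F>_def)
  have \<F>_mult: "set_mult transf A B \<in> \<F>" if "A \<in> \<F>" "B \<in> \<F>" for A B
  proof -
    obtain m n where "A \<in> family_pow transf \<S> m" "B \<in> family_pow transf \<S> n"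
      using \<open>A \<in> \<F>\<close> \<open>B \<in> \<F>\<close> by (auto simp: \<F>_def)
    moreover have "\<Union>\<S> \<subseteq> topspace (arrows transf)"
      using \<S> slices_closed by blast
    ultimately have "set_mult transf A B \<in> family_pow transf \<S> (m + n + 1)"
      by (intro E.family_pow_mult)
    then show ?thesis unfolding \<F>_def by blast
  qed
  have \<D>_\<F>: "{\<one>} \<times> D \<in> \<F>" if "D \<in> \<D>" for D
    \<comment> \<open>Index 0 of \<open>family_pow\<close> is the family itself.\<close>
    using \<D>(2)[OF that] unfolding \<F>_def by (intro UN_I[of 0]) auto
  have slice: "\<exists>V. {g} \<times> V \<in> \<F> \<and> x \<in> V" if "g \<in> carrier G" "x \<in> X" "\<phi> g x \<in> X" for g x
  proof -
    have "(g, x) \<in> topspace (arrows transf)" using that by (simp add: topspace_arrows)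
    then obtain S where "S \<in> \<F>" "(g, x) \<in> S" using gen by blast
    then show ?thesis using \<F>_slices by (auto simp: slices_def)
  qed
  \<comment> \<open>The identity acts trivially, so multiplying two unit slices intersects their
    domains.\<close>
  have one_Int: "{\<one>} \<times> (V \<inter> W) \<in> \<F>" if "{\<one>} \<times> V \<in> \<F>" "{\<one>} \<times> W \<in> \<F>" for V W
  proof -
    have "W \<subseteq> topspace Y"
      using that(2) \<F>_slices compact_open_slice X_subset unfolding compact_open_def by blast
    then have "{x \<in> W. \<phi> \<one> x \<in> V} = V \<inter> W" using act_one by auto
    then show ?thesis using \<F>_mult[OF that] by (simp add: set_mult_slice)
  qed
  have separate: "\<exists>V. {\<one>} \<times> V \<in> \<F> \<and> x \<in> V \<and> y \<notin> V" if xy: "x \<in> X" "y \<in> X" "x \<noteq> y" for x y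
  proof -
    obtain g where g: "g \<in> carrier G" "\<phi> g x \<in> X" "\<phi> g y \<in> X"
        "\<And>D. D \<in> \<D> \<Longrightarrow> \<phi> g x \<in> D \<Longrightarrow> \<phi> g y \<notin> D"
      using sep[OF xy] by blast
    obtain D where D: "D \<in> \<D>" "\<phi> g x \<in> D" using \<D>(1) g(2) by blast
    obtain V where V: "{g} \<times> V \<in> \<F>" "x \<in> V" using slice[OF g(1) xy(1) g(2)] by blast
    have inv: "\<phi> (inv g) (\<phi> g x) = x" using act_inv[OF g(1)] xy(1) X_subset by blast
    obtain V' where V': "{inv g} \<times> V' \<in> \<F>" "\<phi> g x \<in> V'"
      using slice[of "inv g" "\<phi> g x"] g xy(1) inv by auto
    have "\<phi> \<one> (\<phi> g x) = \<phi> g x" using act_one g(2) X_subset by blast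
    \<comment> \<open>The witness is the domain of the triple product. Its group element
      \<open>inv g \<otimes> (\<one> \<otimes> g)\<close> is the identity, and y is excluded because
      gy is not in D.\<close>
    then show ?thesis
      using \<F>_mult[OF V'(1) \<F>_mult[OF \<D>_\<F>[OF D(1)] V(1)]] V V' D g
      by (intro exI[of _ "{z \<in> {z \<in> V. \<phi> g z \<in> D}. \<phi> (\<one> \<otimes> g) z \<in> V'}"])
        (auto simp: set_mult_slice)
  qed
  have small: "\<exists>V. {\<one>} \<times> V \<in> \<F> \<and> x \<in> V \<and> V \<subseteq> W" if W: "openin Y W" "W \<subseteq> X" "x \<in> W" for x W
  proof -
    have xX: "x \<in> X" using W by blast
    define \<V> where "\<V> = {V. {\<one>} \<times> V \<in> \<F> \<and> x \<in> V}"
    have \<V>_closed: "openin (subtopology Y X) (X - V)" if "V \<in> \<V>" for V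
    proof -
      have "{\<one>} \<times> V \<in> slices" "x \<in> V" using that \<F>_slices by (auto simp: \<V>_def)
      then have "compactin (subtopology Y X) V"
        using compact_open_slice by (auto simp: compact_open_def compactin_subtopology)
      then show ?thesis
        using compactin_imp_closedin[OF H] X_subset
        by (metis closedin_def topspace_subtopology_subset)
    qed
    have "closedin (subtopology Y X) (X - W)"
      using W openin_X_iff X_subset
      by (metis closedin_diff closedin_topspace topspace_subtopology_subset)
    then have "compactin (subtopology Y X) (X - W)"
      using comp closedin_compact_space by blast
    \<comment> \<open>As x lies in W, each point outside W differs from x and is separated from it
      by some member of \<open>\<V>\<close>.\<close>
    moreover have "X - W \<subseteq> \<Union>((-) X ` \<V>)"
      using separate[OF xX] W(3) by (fastforce simp: \<V>_def)
    ultimately obtain \<E> where \<E>: "finite \<E>" "\<E> \<subseteq> (-) X ` \<V>" "X - W \<subseteq> \<Union>\<E>"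
      using compactinD[of "subtopology Y X" "X - W" "(-) X ` \<V>"] \<V>_closed by auto
    then obtain \<W> where \<W>: "finite \<W>" "\<W> \<subseteq> \<V>" "X - W \<subseteq> \<Union>((-) X ` \<W>)"
      using finite_subset_image[OF \<E>(1,2)] by blast
    \<comment> \<open>\<open>\<W>\<close> may be empty, and then its intersection is the whole type;
      meeting it with D keeps the set inside X and starts the induction within
      \<open>\<V>\<close>.\<close>
    obtain D where D: "D \<in> \<D>" "x \<in> D" using xX \<D>(1) by blast
    have "D \<inter> \<Inter>\<W> \<in> \<V>"
      using \<W>(1,2)
    proof (induction \<W> rule: finite_induct)
      case empty
      then show ?case using D \<D>_\<F> by (simp add: \<V>_def)
    next
      case (insert V \<W>)
      then have "V \<inter> (D \<inter> \<Inter>\<W>) \<in> \<V>" using one_Int by (auto simp: \<V>_def)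
      then show ?case by (simp add: Int_left_commute)
    qed
    moreover have "D \<subseteq> X"
      using \<D>_\<F>[OF D(1)] \<F>_slices compact_open_slice unfolding compact_open_def by blast
    ultimately show ?thesis
      using \<W>(3) by (intro exI[of _ "D \<inter> \<Inter>\<W>"]) (auto simp: \<V>_def)
  qed
  have "\<exists>S\<in>\<F>. p \<in> S \<and> S \<subseteq> U" if U: "openin (arrows transf) U" and p: "p \<in> U" for U p
  proof -
    obtain g x where gx: "p = (g, x)" "g \<in> carrier G" "x \<in> X" "\<phi> g x \<in> X"
      using p openin_subset[OF U] by (auto simp: topspace_arrows)
    have "openin Y {x. (g, x) \<in> U}" "{x. (g, x) \<in> U} \<subseteq> X"
      using U gx(2) openin_subset[OF U] by (auto simp: openin_arrows[of U] topspace_arrows)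
    then obtain V where V: "{\<one>} \<times> V \<in> \<F>" "x \<in> V" "V \<subseteq> {x. (g, x) \<in> U}"
      using small[of "{x. (g, x) \<in> U}" x] p gx(1) by auto
    \<comment> \<open>Any product through (g, x) will do: multiplying it on the right by {1} x V
      cuts its domain down to a part of V that still contains x.\<close>
    obtain W where W: "{g} \<times> W \<in> \<F>" "x \<in> W" using slice gx by blast
    have "\<phi> \<one> x = x" using act_one gx(3) X_subset by blast
    then show ?thesis
      using \<F>_mult[OF W(1) V(1)] gx V W
      by (intro bexI[of _ "set_mult transf ({g} \<times> W) ({\<one>} \<times> V)"]) (auto simp: set_mult_slice)
  qed
  moreover have "\<And>S. S \<in> \<F> \<Longrightarrow> openin (arrows transf) S"
    using \<F>_slices openin_slices by blast
  ultimately show ?thesis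
    unfolding is_basis_def openin_topology_base_unique by blast
qed

section \<open>Finite covers by compact open sets and slices\<close>

lemma compact_open_neighbourhood:
  assumes Z: "cantor_space (subtopology Y X)" and U: "openin Y U" "x \<in> U" "U \<subseteq> X"
  obtains V where "compact_open V" "x \<in> V" "V \<subseteq> U"
proof -
  obtain V where V: "openin (subtopology Y X) V" "closedin (subtopology Y X) V" "x \<in> V" "V \<subseteq> U"
    using cantor_space_clopen_neighbourhood[OF Z, of U x] U openin_X_iff by blast
  then have "compactin (subtopology Y X) V"
    using cantor_space_imp_compact_space[OF Z] closedin_compact_space by blast
  then show thesis
    using that[of V] V by (auto simp: compact_open_def openin_X_iff compactin_subtopology)
qed

lemma compact_subset_finite_slices:
  assumes Z: "cantor_space (subtopology Y X)" and K: "compactin (arrows transf) K"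
  obtains \<B> where "finite \<B>" "\<B> \<subseteq> slices" "K \<subseteq> \<Union>\<B>"
proof -
  have "K \<subseteq> \<Union>slices"
  proof
    fix p assume "p \<in> K"
    then obtain g x where p: "p = (g, x)" "g \<in> carrier G" "x \<in> X" "\<phi> g x \<in> X"
      using compactin_subset_topspace[OF K] by (auto simp: topspace_arrows)
    obtain V where V: "compact_open V" "x \<in> V" "V \<subseteq> X \<inter> {x \<in> topspace Y. \<phi> g x \<in> X}"
      using compact_open_neighbourhood[OF Z, of "X \<inter> {x \<in> topspace Y. \<phi> g x \<in> X}" x]
        openin_preimage[OF p(2) open_X] open_X p X_subset by blast
    then have "{g} \<times> V \<in> slices" using p(2) unfolding slices_def by blast
    then show "p \<in> \<Union>slices" using p(1) V(2) by blast
  qed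
  then show thesis
    using compactinD[OF K openin_slices] that by blast
qed

text \<open>Compact open sets inside balls of radius \<epsilon>/2 have diameter below \<epsilon>,
  and compactness of X leaves finitely many.\<close>

lemma compact_open_cover_small:
  assumes Z: "cantor_space (subtopology Y X)"
    and M: "Metric_space X d" and top: "Metric_space.mtopology X d = subtopology Y X"
    and \<epsilon>: "\<epsilon> > 0"
  obtains \<D> where "finite \<D>" "X \<subseteq> \<Union>\<D>" "\<And>D. D \<in> \<D> \<Longrightarrow> compact_open D"
    "\<And>D x y. D \<in> \<D> \<Longrightarrow> x \<in> D \<Longrightarrow> y \<in> D \<Longrightarrow> d x y < \<epsilon>"
proof -
  interpret Metric_space X d by (rule M)
  let ?P = "{D. compact_open D \<and> (\<forall>x\<in>D. \<forall>y\<in>D. d x y < \<epsilon>)}"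
  have "X \<subseteq> \<Union>?P"
  proof
    fix x assume x: "x \<in> X"
    have ball: "openin Y (mball x (\<epsilon>/2))" "mball x (\<epsilon>/2) \<subseteq> X" "x \<in> mball x (\<epsilon>/2)"
      using openin_mball[of x "\<epsilon>/2"] x \<epsilon> unfolding top openin_X_iff by auto
    obtain V where V: "compact_open V" "x \<in> V" "V \<subseteq> mball x (\<epsilon>/2)"
      using compact_open_neighbourhood[OF Z ball(1,3,2)] by blast
    have "d y z < \<epsilon>" if "y \<in> V" "z \<in> V" for y z
    proof -
      have "y \<in> X" "z \<in> X" "d x y < \<epsilon>/2" "d x z < \<epsilon>/2"
        using that V by (auto simp: subset_iff)
      then show ?thesis using triangle[of y x z] commute[of x y] x by linarith
    qed
    then show "x \<in> \<Union>?P" using V by blast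
  qed
  moreover have "compactin (subtopology Y X) X"
    using cantor_space_imp_compact_space[OF Z] X_subset
    by (metis compact_space_def topspace_subtopology_subset)
  moreover have "openin (subtopology Y X) D" if "D \<in> ?P" for D
    using that by (auto simp: compact_open_def openin_X_iff)
  ultimately obtain \<D> where "finite \<D>" "\<D> \<subseteq> ?P" "X \<subseteq> \<Union>\<D>"
    using compactinD[of "subtopology Y X" X ?P] by blast
  then show thesis using that[of \<D>] by blast
qed

end

section \<open>Assembling the expansive cover\<close>

theorem lemma5p4:
  fixes G :: "('g, 'm) monoid_scheme"
    and Y :: "'y topology"
    and \<phi> :: "'g \<Rightarrow> 'y \<Rightarrow> 'y"
    and X :: "'y set"
    and d :: "'y \<Rightarrow> 'y \<Rightarrow> real"
  assumes "partial_action G Y \<phi> X"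
    and "cantor_space (subtopology Y X)"
    and "Metric_space X d"
    and "Metric_space.mtopology X d = subtopology Y X"
    and "expansive_partial_action G \<phi> X d"
    and "compactly_generated (transformation_groupoid G Y \<phi> X)"
  shows "expansive_groupoid (transformation_groupoid G Y \<phi> X)"
proof -
  interpret partial_action G Y \<phi> X by (rule assms)
  interpret Metric_space X d by (rule assms)
  interpret G: group G by (rule group_G)
  note Z = \<open>cantor_space (subtopology Y X)\<close>
  have H: "Hausdorff_space (subtopology Y X)"
    using Hausdorff_space_mtopology assms(4) by simp
  obtain K where K: "compact_generating_set transf K"
    using assms(6) by (auto simp: compactly_generated_def)
  obtain \<epsilon> where \<epsilon>: "\<epsilon> > 0"
      "\<And>x y. x \<in> X \<Longrightarrow> y \<in> X \<Longrightarrow> x \<noteq> y \<Longrightarrow>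
        \<exists>g\<in>carrier G. \<phi> g x \<in> X \<and> \<phi> g y \<in> X \<and> d (\<phi> g x) (\<phi> g y) > \<epsilon>"
    using assms(5) by (auto simp: expansive_partial_action_def)
  obtain \<B>\<^sub>0 where \<B>\<^sub>0: "finite \<B>\<^sub>0" "\<B>\<^sub>0 \<subseteq> slices" "K \<subseteq> \<Union>\<B>\<^sub>0"
    using compact_subset_finite_slices[OF Z] K by (auto simp: compact_generating_set_def)
  obtain \<D> where \<D>: "finite \<D>" "X \<subseteq> \<Union>\<D>" "\<And>D. D \<in> \<D> \<Longrightarrow> compact_open D"
      "\<And>D x y. D \<in> \<D> \<Longrightarrow> x \<in> D \<Longrightarrow> y \<in> D \<Longrightarrow> d x y < \<epsilon>"
    using compact_open_cover_small[OF Z assms(3,4) \<epsilon>(1)] by blast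
  have units: "{\<one>\<^bsub>G\<^esub>} \<times> D \<in> slices" if "D \<in> \<D>" for D
  proof -
    have "D \<subseteq> X" using \<D>(3)[OF that] by (simp add: compact_open_def)
    then have "\<phi> \<one>\<^bsub>G\<^esub> ` D \<subseteq> X" using X_subset by (auto simp: act_one subset_iff)
    then show ?thesis using \<D>(3)[OF that] G.one_closed unfolding slices_def by blast
  qed
  \<comment> \<open>\<open>\<B>\<^sub>0\<close> covers K and so provides a product through every
    arrow; the unit slices provide separation.\<close>
  define \<B> where "\<B> = \<B>\<^sub>0 \<union> (\<lambda>D. {\<one>\<^bsub>G\<^esub>} \<times> D) ` \<D>"
  let ?\<S> = "\<B> \<union> (`) (ginv transf) ` \<B>"
  have \<B>: "finite \<B>" "\<B> \<subseteq> slices" "K \<subseteq> \<Union>\<B>"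
    using \<B>\<^sub>0 \<D>(1) units by (auto simp: \<B>_def)
  have \<S>: "?\<S> \<subseteq> slices" using \<B>(2) ginv_slices by blast
  have "topspace (arrows transf) \<subseteq> \<Union>(\<Union>n. family_pow transf ?\<S> n)"
  proof -
    have "K \<union> ginv transf ` K \<subseteq> \<Union>?\<S>" using \<B>(3) by blast
    then have "set_pow transf (K \<union> ginv transf ` K) n \<subseteq> \<Union>(family_pow transf ?\<S> n)" for n
      using set_pow_mono[of _ "\<Union>?\<S>"] set_pow_Union[of transf ?\<S>] by metis
    then have "(\<Union>n. set_pow transf (K \<union> ginv transf ` K) n) \<subseteq> \<Union>(\<Union>n. family_pow transf ?\<S> n)"
      by blast
    then show ?thesis
      using K by (simp add: compact_generating_set_def)
  qed
  then have "is_basis (arrows transf) (\<Union>n. family_pow transf ?\<S> n)"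
  proof (rule is_basis_family_pow[OF cantor_space_imp_compact_space[OF Z] H \<S> _ \<D>(2)])
    show "{\<one>\<^bsub>G\<^esub>} \<times> D \<in> ?\<S>" if "D \<in> \<D>" for D using that by (simp add: \<B>_def)
    show "\<exists>g\<in>carrier G. \<phi> g x \<in> X \<and> \<phi> g y \<in> X \<and> (\<forall>D\<in>\<D>. \<phi> g x \<in> D \<longrightarrow> \<phi> g y \<notin> D)"
      if "x \<in> X" "y \<in> X" "x \<noteq> y" for x y
      \<comment> \<open>A common D would force d(gx, gy) below \<epsilon>, against the choice of
        g.\<close>
      using \<epsilon>(2)[OF that] \<D>(4) by (meson less_asym)
  qed
  then have "expansive_cover transf K \<B>"
    using \<B> bisection_slices by (auto simp: expansive_cover_def)
  then show ?thesis
    using K Z etale_groupoid_transf by (auto simp: expansive_groupoid_def)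
qed

end
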